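(* Let $a,b,c,d,e$ be circles in the plane and assume that $abc\to d$ is a tight implication. Suppose that $e \subseteq \mathrm{CH}(a,b,d) \cap \mathrm{CH}(c,b,d)$ but $e\not \subseteq \mathrm{CH}(b,d)$. Then $e\subseteq \mathrm{CH}(a,d)\cap \mathrm{CH}(c,d)$.
   Context: A circle means a closed disc in $\mathbb{R}^2$ (boundary included), possibly of radius $0$; a circle is identified with its point set. For circles $x_1,\dots,x_k$, $\mathrm{CH}(x_1,\dots,x_k)$ denotes the convex hull of the union of their point sets. For a set $Y$ of circles (written as a word) and a circle $u$, the implication $Y\to u$ means $u\subseteq \mathrm{CH}(Y)$; it is tight if it holds and $u\not\subseteq\mathrm{CH}(Y\setminus\{z\})$ for every $z\in Y$. *)

theory Defs
  imports "HOL-Analysis.Analysis"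
begin

type_synonym plane = "real ^ 2"

text \<open>A circle is a closed disc, identified with its point set; radius 0 (a single point) is allowed.\<close>

definition is_circle :: "plane set \<Rightarrow> bool" where
  "is_circle C \<longleftrightarrow> (\<exists>x r. r \<ge> 0 \<and> C = cball x r)"

definition CH :: "plane set set \<Rightarrow> plane set" where
  "CH Y = convex hull (\<Union>Y)"

definition circ_implies :: "plane set set \<Rightarrow> plane set \<Rightarrow> bool" where
  "circ_implies Y u \<longleftrightarrow> u \<subseteq> CH Y"

definition tight_implication :: "plane set set \<Rightarrow> plane set \<Rightarrow> bool" where
  "tight_implication Y u \<longleftrightarrow> circ_implies Y u \<and> (\<forall>z\<in>Y. \<not> circ_implies (Y - {z}) u)"

end

theory Submission
  imports Defs
begin

text \<open>For a disc with centre \<open>p\<close> and radius \<open>r\<close> the support function in a unit direction \<open>u\<close> is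
  \<open>p \<bullet> u + r\<close>, and \<open>Y \<rightarrow> x\<close> means that the support function of \<open>x\<close> is pointwise at most the maximum
  of those of \<open>Y\<close>.  Subtract the support function of \<open>d\<close> everywhere, obtaining functions
  \<open>f\<^sub>a, f\<^sub>b, f\<^sub>c, f\<^sub>e\<close> on the unit circle that are restrictions of affine functions.  Where such a
  function is positive (or negative) is an arc.  Were \<open>f\<^sub>a, f\<^sub>b, f\<^sub>c\<close> all positive at some \<open>z\<close>, the
  negativity arcs would be intervals in the circle minus \<open>z\<close>; by tightness they meet pairwise, so by
  Helly's theorem all three meet, contradicting \<open>abc \<rightarrow> d\<close>.  Hence the arc \<open>f\<^sub>e > 0\<close> is
  the disjoint union of its open parts \<open>f\<^sub>b > 0\<close> and \<open>f\<^sub>a, f\<^sub>c > 0\<close>.  As \<open>e\<close> is not contained in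
  \<open>CH(b, d)\<close>, the second part is nonempty, so by connectedness it is the whole arc.\<close>

subsection \<open>Support functions\<close>

definition support_fun :: "'a::real_inner set \<Rightarrow> 'a \<Rightarrow> real" where
  "support_fun S u = (SUP x\<in>S. x \<bullet> u)"

lemma bdd_above_inner:
  fixes S :: "'a::real_inner set"
  assumes "bounded S"
  shows "bdd_above ((\<lambda>x. x \<bullet> u) ` S)"
  by (intro bounded_imp_bdd_above bounded_linear_image[OF assms] bounded_linear_inner_left)

lemma support_fun_upper:
  assumes "bounded S" "x \<in> S"
  shows "x \<bullet> u \<le> support_fun S u"
  unfolding support_fun_def by (intro cSUP_upper assms bdd_above_inner)

lemma support_fun_least:
  assumes "S \<noteq> {}" "\<And>x. x \<in> S \<Longrightarrow> x \<bullet> u \<le> m"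
  shows "support_fun S u \<le> m"
  unfolding support_fun_def using assms by (intro cSUP_least)

lemma support_fun_cball:
  fixes x u :: "'a::real_inner"
  assumes "r \<ge> 0" "norm u = 1"
  shows "support_fun (cball x r) u = x \<bullet> u + r"
proof (rule antisym)
  show "support_fun (cball x r) u \<le> x \<bullet> u + r"
  proof (rule support_fun_least)
    fix y assume "y \<in> cball x r"
    then have "norm (y - x) \<le> r"
      by (simp add: dist_norm norm_minus_commute)
    moreover have "(y - x) \<bullet> u \<le> norm (y - x)"
      using norm_cauchy_schwarz[of "y - x" u] assms by simp
    ultimately show "y \<bullet> u \<le> x \<bullet> u + r"
      by (simp add: inner_diff_left)
  qed (use assms in auto)
  have "(x + r *\<^sub>R u) \<bullet> u \<le> support_fun (cball x r) u"
    by (rule support_fun_upper) (use assms in \<open>auto simp: dist_norm\<close>)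
  then show "x \<bullet> u + r \<le> support_fun (cball x r) u"
    using assms by (simp add: inner_add_left dot_square_norm)
qed

text \<open>A half-plane that contains every member of \<open>Y\<close> contains the hull.
  Conversely, the hull is compact, so a line strictly separates it from any point outside, and its
  normal violates the inequality.\<close>

lemma subset_CH_iff_support_fun:
  assumes Y: "finite Y" "Y \<noteq> {}" "\<And>y. y \<in> Y \<Longrightarrow> compact y \<and> y \<noteq> {}"
    and S: "bounded S" "S \<noteq> {}"
  shows "S \<subseteq> CH Y \<longleftrightarrow> (\<forall>u. norm u = 1 \<longrightarrow> (\<exists>y\<in>Y. support_fun S u \<le> support_fun y u))"
proof (intro iffI allI impI)
  fix u :: plane assume "S \<subseteq> CH Y"
  define m where "m = Max ((\<lambda>y. support_fun y u) ` Y)"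
  have "\<Union>Y \<subseteq> {x. u \<bullet> x \<le> m}"
  proof clarsimp
    fix x y assume xy: "x \<in> y" "y \<in> Y"
    then have "x \<bullet> u \<le> support_fun y u"
      by (simp add: Y support_fun_upper compact_imp_bounded)
    also have "\<dots> \<le> m"
      unfolding m_def using xy Y by (intro Max_ge) auto
    finally show "u \<bullet> x \<le> m" by (simp add: inner_commute)
  qed
  then have "CH Y \<subseteq> {x. u \<bullet> x \<le> m}"
    unfolding CH_def by (rule hull_minimal) (rule convex_halfspace_le)
  with \<open>S \<subseteq> CH Y\<close> have "support_fun S u \<le> m"
    by (intro support_fun_least S) (auto simp: inner_commute)
  moreover have "m \<in> (\<lambda>y. support_fun y u) ` Y"
    unfolding m_def using Y by (intro Max_in) auto
  ultimately show "\<exists>y\<in>Y. support_fun S u \<le> support_fun y u" by auto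
next
  assume *: "\<forall>u. norm u = 1 \<longrightarrow> (\<exists>y\<in>Y. support_fun S u \<le> support_fun y u)"
  show "S \<subseteq> CH Y"
  proof (rule ccontr)
    assume "\<not> S \<subseteq> CH Y"
    then obtain x where x: "x \<in> S" "x \<notin> CH Y" by auto
    have "closed (CH Y)"
      unfolding CH_def using Y by (intro compact_imp_closed compact_convex_hull compact_Union) auto
    then obtain n \<beta> where n: "n \<bullet> x < \<beta>" "\<And>y. y \<in> CH Y \<Longrightarrow> \<beta> < n \<bullet> y"
      using separating_hyperplane_closed_point[of "CH Y" x] x by (auto simp: CH_def)
    obtain y0 where "y0 \<in> CH Y"
      using Y hull_subset[of "\<Union>Y" convex] by (fastforce simp: CH_def)
    with n have "n \<noteq> 0" by fastforce
    \<comment> \<open>The separating normal \<open>n\<close> points towards the hull; the sign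
      change makes \<open>u\<close> point towards \<open>x\<close>.\<close>
    define u where "u = (- 1 / norm n) *\<^sub>R n"
    have "norm u = 1"
      using \<open>n \<noteq> 0\<close> by (simp add: u_def)
    then obtain y where y: "y \<in> Y" "support_fun S u \<le> support_fun y u"
      using * by blast
    have "support_fun y u \<le> - \<beta> / norm n"
    proof (rule support_fun_least)
      fix z assume "z \<in> y"
      then have "z \<in> CH Y"
        using y hull_subset[of "\<Union>Y" convex] by (auto simp: CH_def)
      then show "z \<bullet> u \<le> - \<beta> / norm n"
        using n(2)[of z] by (simp add: u_def divide_right_mono inner_commute)
    qed (use Y y in auto)
    moreover have "- \<beta> / norm n < x \<bullet> u"
      using n(1) \<open>n \<noteq> 0\<close> by (simp add: u_def divide_strict_right_mono inner_commute)
    moreover have "x \<bullet> u \<le> support_fun S u"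
      using support_fun_upper[OF S(1) x(1)] .
    ultimately show False using y by linarith
  qed
qed

subsection \<open>Affine functions on the unit circle\<close>

definition affine_fun :: "('a::real_inner \<Rightarrow> real) \<Rightarrow> bool" where
  "affine_fun f \<longleftrightarrow> (\<exists>p q. \<forall>u. f u = p \<bullet> u + q)"

lemma continuous_on_affine_fun:
  assumes "affine_fun f"
  shows "continuous_on S f"
proof -
  obtain p q where "f = (\<lambda>u. p \<bullet> u + q)"
    using assms by (auto simp: affine_fun_def)
  then show ?thesis by (auto intro!: continuous_intros)
qed

section \<open>Stereographic parametrisation of the unit circle\<close>

definition perp :: "plane \<Rightarrow> plane" where
  "perp z = (\<chi> i. if i = 1 then - z $ 2 else z $ 1)"

text \<open>Inverse stereographic projection from \<open>z\<close>: the second intersection of the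
  circle with the line from \<open>z\<close> through \<open>t *\<^sub>R perp z\<close>. The point
  \<open>z\<close> itself is never attained.\<close>

definition inv_stereo :: "plane \<Rightarrow> real \<Rightarrow> plane" where
  "inv_stereo z t = z + (2 / (1 + t\<^sup>2)) *\<^sub>R (t *\<^sub>R perp z - z)"

lemma norm_eq_1_plane: "norm (z::plane) = 1 \<longleftrightarrow> (z$1)\<^sup>2 + (z$2)\<^sup>2 = 1"
  by (simp add: norm_eq_1 inner_vec_def sum_2 power2_eq_square)

lemma one_plus_square_pos: "1 + (t::real)\<^sup>2 > 0"
  by (simp add: add_pos_nonneg)

lemma one_plus_square_cancel: "(1 + (t::real)\<^sup>2) * (2 / (1 + t\<^sup>2)) = 2"
  using one_plus_square_pos[of t] by (metis less_irrefl nonzero_mult_div_cancel_left times_divide_eq_right)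

lemma norm_inv_stereo:
  assumes "norm z = 1"
  shows "norm (inv_stereo z t) = 1"
proof -
  have "z \<bullet> z = 1" "perp z \<bullet> perp z = 1" "z \<bullet> perp z = 0"
    using assms by (auto simp: norm_eq_1_plane perp_def inner_vec_def sum_2 power2_eq_square)
  moreover define s where "s = 2 / (1 + t\<^sup>2)"
  ultimately have "inv_stereo z t \<bullet> inv_stereo z t = 1 - 2 * s + s * (s * (1 + t\<^sup>2))"
    unfolding inv_stereo_def s_def[symmetric]
    by (simp add: inner_add_left inner_add_right inner_diff_left inner_diff_right inner_commute
        power2_eq_square algebra_simps)
  moreover have "s * (1 + t\<^sup>2) = 2"
    unfolding s_def by (subst mult.commute) (rule one_plus_square_cancel)
  ultimately show ?thesis by (simp add: norm_eq_1)
qed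

lemma inv_stereo_surj:
  assumes z: "norm z = 1" and v: "norm v = 1" and ne: "v \<noteq> z"
  obtains t where "v = inv_stereo z t"
proof
  \<comment> \<open>In the orthonormal basis \<open>z\<close>, \<open>perp z\<close>, the vector
    \<open>v - z\<close> has coordinates \<open>-m\<close> and \<open>k\<close>, so its slope
    \<open>k / m\<close> is the parameter sought.\<close>
  define m where "m = 1 - v \<bullet> z"
  define k where "k = v \<bullet> perp z"
  have "v \<bullet> z \<noteq> 1"
    using ne z v by (metis norm_cauchy_schwarz_eq mult_1 scaleR_one)
  then have m: "m \<noteq> 0" by (simp add: m_def)
  have zz: "(z$1)\<^sup>2 + (z$2)\<^sup>2 = 1" and vv: "(v$1)\<^sup>2 + (v$2)\<^sup>2 = 1"
    using z v by (auto simp: norm_eq_1_plane)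
  have md: "m = 1 - (v$1 * z$1 + v$2 * z$2)" and kd: "k = v$2 * z$1 - v$1 * z$2"
    by (simp_all add: m_def k_def perp_def inner_vec_def sum_2)
  have "k\<^sup>2 + (1 - m)\<^sup>2 = 1"
    unfolding md kd using zz vv by algebra
  then have "m\<^sup>2 + k\<^sup>2 = 2 * m" by algebra
  then have s: "2 / (1 + (k / m)\<^sup>2) = m"
    using m by (simp add: field_simps power2_eq_square)
  have "v = z + (k *\<^sub>R perp z - m *\<^sub>R z)"
  proof (subst vec_eq_iff, rule, goal_cases)
    case (1 i)
    have "v$1 = z$1 + (- k * z$2 - m * z$1)" "v$2 = z$2 + (k * z$1 - m * z$2)"
      unfolding md kd using zz by algebra+
    then show ?case
      using exhaust_2[of i] by (auto simp: perp_def)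
  qed
  then show "v = inv_stereo z (k / m)"
    unfolding inv_stereo_def s using m by (simp add: algebra_simps)
qed

lemma continuous_on_inv_stereo: "continuous_on S (inv_stereo z)"
  unfolding inv_stereo_def using one_plus_square_pos
  by (intro continuous_intros) (metis less_irrefl)

text \<open>Clearing the denominator of the stereographic parametrisation turns an affine function into a
  quadratic polynomial whose leading coefficient is its value at the centre of projection.\<close>

lemma affine_fun_inv_stereo:
  assumes "affine_fun f"
  obtains B C where "\<And>t. (1 + t\<^sup>2) * f (inv_stereo z t) = f z * t\<^sup>2 + B * t + C"
proof -
  obtain p q where f: "\<And>u. f u = p \<bullet> u + q"
    using assms by (auto simp: affine_fun_def)
  show ?thesis
  proof
    fix t :: real
    have "f (inv_stereo z t) = f z + 2 / (1 + t\<^sup>2) * (t * (p \<bullet> perp z) - p \<bullet> z)"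
      by (simp add: f inv_stereo_def inner_add_right inner_diff_right)
    then have "(1 + t\<^sup>2) * f (inv_stereo z t)
        = (1 + t\<^sup>2) * f z + 2 * (t * (p \<bullet> perp z) - p \<bullet> z)"
      by (simp only: distrib_left mult.assoc[symmetric] one_plus_square_cancel)
    then show "(1 + t\<^sup>2) * f (inv_stereo z t)
        = f z * t\<^sup>2 + (2 * (p \<bullet> perp z)) * t + (f z - 2 * (p \<bullet> z))"
      by (simp add: algebra_simps)
  qed
qed

section \<open>Sign arcs of affine functions\<close>

lemma convex_quadratic_between:
  fixes A B C r s t :: real
  assumes "A \<ge> 0" "r \<le> s" "s \<le> t" "A * r\<^sup>2 + B * r + C < 0" "A * t\<^sup>2 + B * t + C < 0"
  shows "A * s\<^sup>2 + B * s + C < 0"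
proof (cases "r = t")
  case False
  then have rt: "r < t" using assms by simp
  \<comment> \<open>A quadratic equals its chord on \<open>[r, t]\<close> minus
    \<open>A * (t - s) * (s - r)\<close>; the identity is multiplied by \<open>t - r\<close> to
    avoid division.\<close>
  have "(t - r) * (A * s\<^sup>2 + B * s + C)
      = (t - s) * (A * r\<^sup>2 + B * r + C) + (s - r) * (A * t\<^sup>2 + B * t + C)
        - A * ((t - r) * (t - s) * (s - r))"
    by (simp add: power2_eq_square algebra_simps)
  moreover have "A * ((t - r) * (t - s) * (s - r)) \<ge> 0"
    using assms rt by simp
  moreover have "(t - s) * (A * r\<^sup>2 + B * r + C) + (s - r) * (A * t\<^sup>2 + B * t + C) < 0"
  proof (cases "s = r")
    case True
    then show ?thesis using assms rt by (simp add: mult_pos_neg)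
  next
    case False
    then have "(s - r) * (A * t\<^sup>2 + B * t + C) < 0"
      using assms by (simp add: mult_pos_neg)
    moreover have "(t - s) * (A * r\<^sup>2 + B * r + C) \<le> 0"
      using assms by (simp add: mult_nonneg_nonpos)
    ultimately show ?thesis by linarith
  qed
  ultimately have "(t - r) * (A * s\<^sup>2 + B * s + C) < 0" by linarith
  then show ?thesis using rt by (simp add: mult_less_0_iff)
qed (use assms in auto)

text \<open>Multiplying by the positive factor \<open>1 + t\<^sup>2\<close> keeps the sign and gives
  a quadratic with leading coefficient \<open>f z\<close>, which is convex when
  \<open>f z \<ge> 0\<close>.\<close>

lemma affine_fun_neg_between:
  assumes f: "affine_fun f" and z: "f z \<ge> 0" and rst: "r \<le> s" "s \<le> t"
    and neg: "f (inv_stereo z r) < 0" "f (inv_stereo z t) < 0"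
  shows "f (inv_stereo z s) < 0"
proof -
  obtain B C where q: "\<And>t. (1 + t\<^sup>2) * f (inv_stereo z t) = f z * t\<^sup>2 + B * t + C"
    using affine_fun_inv_stereo[OF f] by blast
  have iff: "f (inv_stereo z t) < 0 \<longleftrightarrow> f z * t\<^sup>2 + B * t + C < 0" for t
    using one_plus_square_pos[of t] by (simp add: q[symmetric] mult_less_0_iff)
  show ?thesis
    using convex_quadratic_between[OF z rst] neg by (simp add: iff)
qed

text \<open>If \<open>f\<close> is positive on the whole circle, the set is the circle. Otherwise
  project from a point where \<open>f \<le> 0\<close>: the set is the image of an interval of
  parameters.\<close>

lemma connected_affine_fun_pos:
  fixes f :: "plane \<Rightarrow> real"
  assumes f: "affine_fun f"
  shows "connected {u. norm u = 1 \<and> f u > 0}" (is "connected ?E")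
proof (cases "\<exists>z. norm z = 1 \<and> f z \<le> 0")
  case False
  then have "?E = sphere 0 1" by (auto simp: not_le)
  then show ?thesis using connected_sphere[of "0::plane" 1] by simp
next
  case True
  then obtain z where z: "norm z = 1" "f z \<le> 0" by blast
  define g where "g u = - f u" for u
  obtain p q where "\<And>u. f u = p \<bullet> u + q"
    using f by (auto simp: affine_fun_def)
  then have "\<And>u. g u = (- p) \<bullet> u + (- q)" by (simp add: g_def)
  then have g: "affine_fun g" unfolding affine_fun_def by blast
  let ?T = "{t. f (inv_stereo z t) > 0}"
  have "is_interval ?T"
    unfolding is_interval_1
    using affine_fun_neg_between[OF g, of z] z by (auto simp: g_def)
  then have "connected (inv_stereo z ` ?T)"
    by (intro connected_continuous_image continuous_on_inv_stereo) (simp add: is_interval_connected_1)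
  moreover have "inv_stereo z ` ?T = ?E"
  proof (intro equalityI subsetI)
    fix v assume "v \<in> ?E"
    then have "norm v = 1" "v \<noteq> z" "f v > 0" using z by auto
    then show "v \<in> inv_stereo z ` ?T"
      using inv_stereo_surj[OF z(1)] by (metis (mono_tags, lifting) imageI mem_Collect_eq)
  qed (use z norm_inv_stereo in auto)
  ultimately show ?thesis by simp
qed

lemma no_common_positive_point:
  fixes f g h :: "plane \<Rightarrow> real"
  assumes aff: "affine_fun f" "affine_fun g" "affine_fun h"
    and cover: "\<And>u. norm u = 1 \<Longrightarrow> f u \<ge> 0 \<or> g u \<ge> 0 \<or> h u \<ge> 0"
    and x: "norm x = 1" "g x < 0" "h x < 0"
    and y: "norm y = 1" "f y < 0" "h y < 0"
    and w: "norm w = 1" "f w < 0" "g w < 0"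
    and z: "norm z = 1" "f z > 0" "g z > 0" "h z > 0"
  shows False
proof -
  have ne: "x \<noteq> z" "y \<noteq> z" "w \<noteq> z"
    using x y w z by auto
  obtain r where r: "x = inv_stereo z r"
    using inv_stereo_surj[OF z(1) x(1) ne(1)] .
  obtain s where s: "y = inv_stereo z s"
    using inv_stereo_surj[OF z(1) y(1) ne(2)] .
  obtain t where t: "w = inv_stereo z t"
    using inv_stereo_surj[OF z(1) w(1) ne(3)] .
  note between =
    affine_fun_neg_between[OF aff(1) less_imp_le[OF z(2)]]
    affine_fun_neg_between[OF aff(2) less_imp_le[OF z(3)]]
    affine_fun_neg_between[OF aff(3) less_imp_le[OF z(4)]]
  \<comment> \<open>One-dimensional Helly: the function known to be negative at the two outer points
    is also negative at the middle one, where the other two are negative already.\<close>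
  consider "s \<le> r" "r \<le> t" | "t \<le> r" "r \<le> s" | "r \<le> s" "s \<le> t" | "t \<le> s" "s \<le> r"
    | "r \<le> t" "t \<le> s" | "s \<le> t" "t \<le> r" by linarith
  then have "f x < 0 \<or> g y < 0 \<or> h w < 0"
    using between x y w unfolding r s t by cases blast+
  then show False
    using cover[OF x(1)] cover[OF y(1)] cover[OF w(1)] x y w by auto
qed

section \<open>From inclusions of circles to affine functions\<close>

lemma affine_fun_support_fun_diff:
  assumes "is_circle x" "is_circle d"
  obtains f where "affine_fun f" "\<And>u. norm u = 1 \<Longrightarrow> support_fun x u - support_fun d u = f u"
proof -
  obtain p r p' r' where "r \<ge> 0" "x = cball p r" "r' \<ge> 0" "d = cball p' r'"
    using assms by (auto simp: is_circle_def)
  \<comment> \<open>For general \<open>u\<close> each radius would be multiplied by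
    \<open>norm u\<close>, so the affine formula is claimed for unit vectors only.\<close>
  then have "\<And>u. norm u = 1 \<Longrightarrow> support_fun x u - support_fun d u = (p - p') \<bullet> u + (r - r')"
    by (simp add: support_fun_cball inner_diff_left)
  moreover have "affine_fun (\<lambda>u. (p - p') \<bullet> u + (r - r'))"
    unfolding affine_fun_def by blast
  ultimately show ?thesis using that by blast
qed

lemma circle_subset_CH_iff:
  assumes "finite Y" "Y \<noteq> {}" "\<forall>y\<in>Y. is_circle y" "is_circle S"
  shows "S \<subseteq> CH Y \<longleftrightarrow> (\<forall>u. norm u = 1 \<longrightarrow> (\<exists>y\<in>Y. support_fun S u \<le> support_fun y u))"
proof (rule subset_CH_iff_support_fun)
  show "compact y \<and> y \<noteq> {}" if y: "y \<in> Y" for y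
  proof -
    obtain x r where "r \<ge> 0" "y = cball x r"
      using y assms(3) unfolding is_circle_def by blast
    then show ?thesis by simp
  qed
  show "bounded S" "S \<noteq> {}"
    using assms(4) by (auto simp: is_circle_def)
qed (use assms in auto)

theorem theorem5p4:
  fixes a b c d e :: "plane set"
  assumes "is_circle a" "is_circle b" "is_circle c" "is_circle d" "is_circle e"
    and "distinct [a, b, c]"
    and "tight_implication {a, b, c} d"
    and "e \<subseteq> CH {a, b, d} \<inter> CH {c, b, d}"
    and "\<not> e \<subseteq> CH {b, d}"
  shows "e \<subseteq> CH {a, d} \<inter> CH {c, d}"
proof -
  note circles = assms(1-5)
  obtain fa where fa: "affine_fun fa" "\<And>u. norm u = 1 \<Longrightarrow> support_fun a u - support_fun d u = fa u"
    using affine_fun_support_fun_diff[OF circles(1,4)] by blast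
  obtain fb where fb: "affine_fun fb" "\<And>u. norm u = 1 \<Longrightarrow> support_fun b u - support_fun d u = fb u"
    using affine_fun_support_fun_diff[OF circles(2,4)] by blast
  obtain fc where fc: "affine_fun fc" "\<And>u. norm u = 1 \<Longrightarrow> support_fun c u - support_fun d u = fc u"
    using affine_fun_support_fun_diff[OF circles(3,4)] by blast
  obtain fe where fe: "affine_fun fe" "\<And>u. norm u = 1 \<Longrightarrow> support_fun e u - support_fun d u = fe u"
    using affine_fun_support_fun_diff[OF circles(5,4)] by blast
  have supp: "support_fun a u = fa u + support_fun d u" "support_fun b u = fb u + support_fun d u"
    "support_fun c u = fc u + support_fun d u" "support_fun e u = fe u + support_fun d u"
    if "norm u = 1" for u
    using fa(2)[OF that] fb(2)[OF that] fc(2)[OF that] fe(2)[OF that] by linarith+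

  \<comment> \<open>Distinctness ensures that deleting one circle leaves both others.\<close>
  have "{a, b, c} - {a} = {b, c}" "{a, b, c} - {b} = {a, c}" "{a, b, c} - {c} = {a, b}"
    using assms(6) by auto
  then have "d \<subseteq> CH {a, b, c}" "\<not> d \<subseteq> CH {b, c}" "\<not> d \<subseteq> CH {a, c}" "\<not> d \<subseteq> CH {a, b}"
    using assms(7) by (auto simp: tight_implication_def circ_implies_def)
  then have cover: "\<And>u. norm u = 1 \<Longrightarrow> fa u \<ge> 0 \<or> fb u \<ge> 0 \<or> fc u \<ge> 0"
    and "\<exists>u. norm u = 1 \<and> fb u < 0 \<and> fc u < 0"
    and "\<exists>u. norm u = 1 \<and> fa u < 0 \<and> fc u < 0"
    and "\<exists>u. norm u = 1 \<and> fa u < 0 \<and> fb u < 0"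
    using circles by (auto simp: circle_subset_CH_iff supp not_le cong: conj_cong imp_cong)
  then have triple: "\<not> (fa u > 0 \<and> fb u > 0 \<and> fc u > 0)" if "norm u = 1" for u
    using no_common_positive_point[OF fa(1) fb(1) fc(1)] that by blast

  have "e \<subseteq> CH {a, b, d}" "e \<subseteq> CH {c, b, d}" using assms(8) by auto
  then have e: "fe u \<le> fa u \<or> fe u \<le> fb u \<or> fe u \<le> 0" "fe u \<le> fc u \<or> fe u \<le> fb u \<or> fe u \<le> 0"
    if "norm u = 1" for u
    using circles that by (auto simp: circle_subset_CH_iff supp)
  obtain v where v: "norm v = 1" "fe v > fb v" "fe v > 0"
    using assms(9) circles by (auto simp: circle_subset_CH_iff supp not_le cong: conj_cong imp_cong)

  define E where "E = {u. norm u = 1 \<and> fe u > 0}"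
  have "connected E"
    unfolding E_def by (rule connected_affine_fun_pos[OF fe(1)])
  moreover have "open {u. fb u > 0}" "open ({u. fa u > 0} \<inter> {u. fc u > 0})"
    using continuous_on_affine_fun[of _ UNIV] fa(1) fb(1) fc(1)
    by (auto intro!: open_Int open_Collect_less continuous_on_const)
  moreover have "{u. fb u > 0} \<inter> ({u. fa u > 0} \<inter> {u. fc u > 0}) \<inter> E = {}"
    using triple by (auto simp: E_def)
  \<comment> \<open>On \<open>E\<close> the alternative \<open>fe u \<le> 0\<close> fails, so either
    \<open>fb u\<close> or both \<open>fa u\<close> and \<open>fc u\<close> are at least
    \<open>fe u > 0\<close>.\<close>
  moreover have "E \<subseteq> {u. fb u > 0} \<union> ({u. fa u > 0} \<inter> {u. fc u > 0})"
  proof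
    fix u assume "u \<in> E"
    then show "u \<in> {u. fb u > 0} \<union> ({u. fa u > 0} \<inter> {u. fc u > 0})"
      using e[of u] by (auto simp: E_def)
  qed
  ultimately have "{u. fb u > 0} \<inter> E = {} \<or> {u. fa u > 0} \<inter> {u. fc u > 0} \<inter> E = {}"
    by (rule connectedD)
  moreover have "v \<in> {u. fa u > 0} \<inter> {u. fc u > 0} \<inter> E"
    using e[OF v(1)] v by (auto simp: E_def)
  ultimately have "{u. fb u > 0} \<inter> E = {}" by blast
  \<comment> \<open>Where \<open>fe u > 0\<close>, now \<open>fb u \<le> 0 < fe u\<close>, which
    rules out the alternative through \<open>b\<close>.\<close>
  then have "fe u \<le> fa u \<or> fe u \<le> 0" "fe u \<le> fc u \<or> fe u \<le> 0" if "norm u = 1" for u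
    using e[OF that] that by (force simp: E_def)+
  then show ?thesis
    using circles by (auto simp: circle_subset_CH_iff supp)
qed

end
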